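(* Let $\alpha = \frac{9-\sqrt{5}}{38}$, let $$P = \begin{pmatrix} 1 & 1/2 & 1/2 \\ 1/2 & 1/2 & 1/2 \\ 1/2 & 1/2 & 0 \end{pmatrix},\qquad H = \begin{pmatrix} 1 & \alpha & 2\alpha \\ \alpha & 0 & \alpha \\ 2\alpha & \alpha & 0 \end{pmatrix}$$ be tables of probabilities in Collins–Gisin notation, and for $\mu\in\mathbb{R}$ let $l_2(\mu) = \mu P + (1-\mu)H$. Then the maximum of $\mu$ over all $\mu\in\mathbb{R}$ such that $l_2(\mu)$ belongs to the Almost Quantum set exists and is equal to $5\sqrt{5}-11$. (That is, $l_2(5\sqrt{5}-11)$ belongs to the Almost Quantum set, and every real $\mu$ for which $l_2(\mu)$ belongs to the Almost Quantum set satisfies $\mu\le 5\sqrt{5}-11$.)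
   Context: Bipartite scenario with two settings and two outcomes per party. A table in Collins–Gisin notation is a real $3\times 3$ matrix $$\begin{pmatrix} 1 & p_B(0) & p_B(1) \\ p_A(0) & p(0,0) & p(0,1) \\ p_A(1) & p(1,0) & p(1,1) \end{pmatrix},$$ where $p_A(x)$ (resp. $p_B(y)$) is the probability that Alice (resp. Bob) obtains the first outcome for setting $x$ (resp. $y$), and $p(x,y)$ is the probability that both obtain the first outcome for settings $x,y\in\{0,1\}$. Almost Quantum set: a table in Collins–Gisin notation with entries $p_A(x), p_B(y), p(x,y)$, $x,y\in\{0,1\}$, belongs to the Almost Quantum set if and only if there exist real numbers $a_{01}, b_{01}, c_{0,01}, c_{1,01}, c_{01,0}, c_{01,1}, c_{01,01}, c_{01,10}$ such that the following real symmetric $9\times 9$ matrix (only the upper triangle is displayed; the lower triangle is determined by symmetry) is positive semidefinite. Rows and columns are indexed, in order, by the words $1, A_0, A_1, B_0, B_1, A_0B_0, A_0B_1, A_1B_0, A_1B_1$: $$\begin{pmatrix} 1 & p_A(0) & p_A(1) & p_B(0) & p_B(1) & p(0,0) & p(0,1) & p(1,0) & p(1,1) \\ & p_A(0) & a_{01} & p(0,0) & p(0,1) & p(0,0) & p(0,1) & c_{01,0} & c_{01,1} \\ & & p_A(1) & p(1,0) & p(1,1) & c_{01,0} & c_{01,1} & p(1,0) & p(1,1) \\ & & & p_B(0) & b_{01} & p(0,0) & c_{0,01} & p(1,0) & c_{1,01} \\ & & & & p_B(1) & c_{0,01} & p(0,1) & c_{1,01} & p(1,1) \\ & & & & & p(0,0)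 & c_{0,01} & c_{01,0} & c_{01,01} \\ & & & & & & p(0,1) & c_{01,10} & c_{01,1} \\ & & & & & & & p(1,0) & c_{1,01} \\ & & & & & & & & p(1,1) \end{pmatrix} \ge 0.$$ *)

theory Defs
  imports "HOL-Analysis.Analysis"
begin

definition positive_semidefinite :: "real ^ 'n ^ 'n \<Rightarrow> bool" where
  "positive_semidefinite M \<longleftrightarrow> transpose M = M \<and> (\<forall>x. 0 \<le> x \<bullet> (M *v x))"

(* Settings are the two elements 0 and 1 of the type 2. *)
definition collins_gisin ::
    "(2 \<Rightarrow> real) \<Rightarrow> (2 \<Rightarrow> real) \<Rightarrow> (2 \<Rightarrow> 2 \<Rightarrow> real) \<Rightarrow> real ^ 3 ^ 3" where
  "collins_gisin pA pB p = vector
    [vector [1,    pB 0,  pB 1 ],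
     vector [pA 0, p 0 0, p 0 1],
     vector [pA 1, p 1 0, p 1 1]]"

(* Rows and columns are indexed, in order, by the words
   1, A0, A1, B0, B1, A0B0, A0B1, A1B0, A1B1.  A parameter such as c01_10 is the entry written
   c with subscript "01,10"; the part before the underscore lists Alice's settings, the part
   after it Bob's. *)
definition aq_matrix ::
    "(2 \<Rightarrow> real) \<Rightarrow> (2 \<Rightarrow> real) \<Rightarrow> (2 \<Rightarrow> 2 \<Rightarrow> real) \<Rightarrow> real \<Rightarrow> real \<Rightarrow> real \<Rightarrow> real \<Rightarrow> real \<Rightarrow> real \<Rightarrow>
     real \<Rightarrow> real \<Rightarrow> real ^ 9 ^ 9" where
  "aq_matrix pA pB p a01 b01 c0_01 c1_01 c01_0 c01_1 c01_01 c01_10 = vector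
    [vector [1,     pA 0,  pA 1,  pB 0,  pB 1,  p 0 0,  p 0 1,  p 1 0,  p 1 1 ],
     vector [pA 0,  pA 0,  a01,   p 0 0, p 0 1, p 0 0,  p 0 1,  c01_0,  c01_1 ],
     vector [pA 1,  a01,   pA 1,  p 1 0, p 1 1, c01_0,  c01_1,  p 1 0,  p 1 1 ],
     vector [pB 0,  p 0 0, p 1 0, pB 0,  b01,   p 0 0,  c0_01,  p 1 0,  c1_01 ],
     vector [pB 1,  p 0 1, p 1 1, b01,   pB 1,  c0_01,  p 0 1,  c1_01,  p 1 1 ],
     vector [p 0 0, p 0 0, c01_0, p 0 0, c0_01, p 0 0,  c0_01,  c01_0,  c01_01],
     vector [p 0 1, p 0 1, c01_1, c0_01, p 0 1, c0_01,  p 0 1,  c01_10, c01_1 ],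
     vector [p 1 0, c01_0, p 1 0, p 1 0, c1_01, c01_0,  c01_10, p 1 0,  c1_01 ],
     vector [p 1 1, c01_1, p 1 1, c1_01, p 1 1, c01_01, c01_1,  c1_01,  p 1 1 ]]"

definition almost_quantum_set :: "(real ^ 3 ^ 3) set" where
  "almost_quantum_set = {collins_gisin pA pB p | pA pB p.
     \<exists>a01 b01 c0_01 c1_01 c01_0 c01_1 c01_01 c01_10.
       positive_semidefinite (aq_matrix pA pB p a01 b01 c0_01 c1_01 c01_0 c01_1 c01_01 c01_10)}"

end

(* With s = pA(0) - p(0,0), the tables on the line satisfy Hardy's conditions
   p(0,1) = pA(0), p(1,0) = pB(0), p(1,1) = 0.  Reading the moment matrix as a Gram matrix, these
   say that the vectors of A0 and A0B1 coincide, those of B0 and A1B0 coincide, and that of A1B1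
   vanishes; hence a01 = b01 = 0.  The form restricted to the span of A0 - B0 and A1 - B1 is then
   fixed by the table, and its value at f (A0 - B0) + (A1 - B1), f the golden ratio, gives a linear
   bound on mu, which is equivalent to s >= f p(0,0).  At equality p(0,0) = f^-5, s = f^-4, and
   the remaining moment matrix has rank 4 and is an explicit sum of squares. *)
theory Submission
  imports Defs
begin

lemma exhaust_9: "x = 1 \<or> x = 2 \<or> x = 3 \<or> x = 4 \<or> x = 5 \<or> x = 6 \<or> x = 7 \<or> x = 8 \<or> x = 9"
  for x :: 9
proof (induct x)
  case (of_int z)
  then have "0 \<le> z" and "z < 9" by simp_all
  then have "z = 0 \<or> z = 1 \<or> z = 2 \<or> z = 3 \<or> z = 4 \<or> z = 5 \<or> z = 6 \<or> z = 7 \<or> z = 8"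
    by arith
  then show ?case by auto
qed

lemma UNIV_9: "(UNIV :: 9 set) = {1, 2, 3, 4, 5, 6, 7, 8, 9}"
  using exhaust_9 by auto

lemma forall_9: "(\<forall>i::9. P i) \<longleftrightarrow> P 1 \<and> P 2 \<and> P 3 \<and> P 4 \<and> P 5 \<and> P 6 \<and> P 7 \<and> P 8 \<and> P 9"
proof -
  have "(\<forall>i::9. P i) \<longleftrightarrow> (\<forall>i\<in>UNIV. P i)" by simp
  then show ?thesis unfolding UNIV_9 by simp
qed

lemma sum_9: "sum f (UNIV :: 9 set) = f 1 + f 2 + f 3 + f 4 + f 5 + f 6 + f 7 + f 8 + f 9"
  unfolding UNIV_9 by (simp add: ac_simps)

lemma vector_9 [simp]:
  "(vector [a, b, c, d, e, f, g, h, k] :: 'a::zero ^ 9) $ 1 = a"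
  "(vector [a, b, c, d, e, f, g, h, k] :: 'a::zero ^ 9) $ 2 = b"
  "(vector [a, b, c, d, e, f, g, h, k] :: 'a::zero ^ 9) $ 3 = c"
  "(vector [a, b, c, d, e, f, g, h, k] :: 'a::zero ^ 9) $ 4 = d"
  "(vector [a, b, c, d, e, f, g, h, k] :: 'a::zero ^ 9) $ 5 = e"
  "(vector [a, b, c, d, e, f, g, h, k] :: 'a::zero ^ 9) $ 6 = f"
  "(vector [a, b, c, d, e, f, g, h, k] :: 'a::zero ^ 9) $ 7 = g"
  "(vector [a, b, c, d, e, f, g, h, k] :: 'a::zero ^ 9) $ 8 = h"
  "(vector [a, b, c, d, e, f, g, h, k] :: 'a::zero ^ 9) $ 9 = k"
  unfolding vector_def by simp_all

lemma axis_inner_mult_axis: "axis i 1 \<bullet> (M *v axis j 1) = M $ i $ j"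
  for M :: "real ^ 'n ^ 'n"
  by (simp add: inner_axis' matrix_vector_mult_basis column_def)

text \<open>Moving from \<open>x\<close> by \<open>-t\<close> times \<open>y = M *v x\<close>
  changes the form by \<open>-2 * t * (y \<bullet> y)\<close> to first order, so it would turn
  negative for small \<open>t > 0\<close> unless \<open>y = 0\<close>.\<close>

lemma positive_semidefinite_null:
  fixes M :: "real ^ 'n ^ 'n"
  assumes psd: "positive_semidefinite M" and null: "x \<bullet> (M *v x) = 0"
  shows "M *v x = 0"
proof -
  define y where "y = M *v x"
  define c where "c = y \<bullet> (M *v y)"
  have sym: "transpose M = M" and nonneg: "\<And>z. 0 \<le> z \<bullet> (M *v z)"
    using psd by (auto simp: positive_semidefinite_def)
  have "x \<bullet> (M *v y) = y \<bullet> y"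
    using sym by (metis dot_lmul_matrix transpose_matrix_vector y_def)
  then have expand: "(x - t *\<^sub>R y) \<bullet> (M *v (x - t *\<^sub>R y)) = t\<^sup>2 * c - 2 * t * (y \<bullet> y)" for t
    using null by (simp add: c_def y_def[symmetric] algebra_simps matrix_vector_mult_diff_distrib
        matrix_vector_mult_scaleR inner_diff inner_commute power2_eq_square)
  have "0 \<le> c" using nonneg by (simp add: c_def)
  \<comment> \<open>The minimiser would be \<open>(y \<bullet> y) / c\<close>; the added 1 covers
    \<open>c = 0\<close>, and the form at this \<open>t\<close> is
    \<open>-(t^2) * (c + 2)\<close>.\<close>
  define t where "t = (y \<bullet> y) / (c + 1)"
  have "y \<bullet> y = t * (c + 1)" using \<open>0 \<le> c\<close> by (simp add: t_def)
  then have "t\<^sup>2 * (c + 2) \<le> 0"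
    using nonneg[of "x - t *\<^sub>R y"] unfolding expand by (simp add: algebra_simps power2_eq_square)
  then have "t = 0" using \<open>0 \<le> c\<close>
    by (simp add: mult_le_0_iff)
  with \<open>y \<bullet> y = t * (c + 1)\<close> show ?thesis by (simp add: y_def)
qed

lemma positive_semidefinite_zero_diagonal:
  fixes M :: "real ^ 'n ^ 'n"
  assumes "positive_semidefinite M" and "M $ i $ i = 0"
  shows "M $ k $ i = 0"
proof -
  have "M *v axis i 1 = 0"
    using assms by (intro positive_semidefinite_null) (simp_all add: axis_inner_mult_axis)
  then show ?thesis using axis_inner_mult_axis[of k M i] by simp
qed

text \<open>The Gram vectors of \<open>i\<close> and \<open>j\<close> have squared distance
  \<open>M_ii - 2 * M_ij + M_jj = 0\<close>, so \<open>axis i 1 - axis j 1\<close> is a null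
  vector.\<close>

lemma positive_semidefinite_equal_columns:
  fixes M :: "real ^ 'n ^ 'n"
  assumes "positive_semidefinite M" and "M $ i $ j = M $ i $ i" and "M $ j $ j = M $ i $ i"
  shows "M $ k $ i = M $ k $ j"
proof -
  have "transpose M $ i $ j = M $ j $ i"
    by (simp add: transpose_def)
  then have "M $ j $ i = M $ i $ j"
    using assms(1) by (simp add: positive_semidefinite_def)
  then have "M *v (axis i 1 - axis j 1) = 0"
    using assms
    by (intro positive_semidefinite_null)
      (simp_all add: matrix_vector_mult_diff_distrib inner_diff axis_inner_mult_axis)
  then have "axis k 1 \<bullet> (M *v axis i 1) = axis k 1 \<bullet> (M *v axis j 1)"
    by (simp add: matrix_vector_mult_diff_distrib)
  then show ?thesis by (simp add: axis_inner_mult_axis)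
qed

text \<open>Among the words A0, A1, B0, B1 the only free parameters are \<open>a01\<close> and
  \<open>b01\<close>; both are forced to vanish, so the form depends on the table alone.\<close>

lemma hardy_table_antisymmetric_form:
  assumes psd: "positive_semidefinite
      (aq_matrix pA pB p a01 b01 c0_01 c1_01 c01_0 c01_1 c01_01 c01_10)"
    and "p 1 1 = 0" and "p 0 1 = pA 0" and "p 1 0 = pB 0"
  shows "0 \<le> u\<^sup>2 * (pA 0 + pB 0 - 2 * p 0 0) - 2 * u * v * (pA 0 + pB 0)
             + v\<^sup>2 * (pA 1 + pB 1)"
proof -
  define M where "M = aq_matrix pA pB p a01 b01 c0_01 c1_01 c01_0 c01_1 c01_01 c01_10"
  have psd: "positive_semidefinite M" using psd by (simp add: M_def)
  have "M $ 2 $ 9 = 0" "M $ 4 $ 9 = 0"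
    by (rule positive_semidefinite_zero_diagonal[OF psd]; simp add: M_def aq_matrix_def assms)+
  then have "c01_1 = 0" "c1_01 = 0"
    by (simp_all add: M_def aq_matrix_def)
  \<comment> \<open>Indices 2, 7 are A0, A0B1 and 4, 8 are B0, A1B0; rows A1 and B1 thus identify
    \<open>a01\<close> with \<open>c01_1\<close> and \<open>b01\<close> with
    \<open>c1_01\<close>.\<close>
  moreover have "M $ 3 $ 2 = M $ 3 $ 7" "M $ 5 $ 4 = M $ 5 $ 8"
    by (rule positive_semidefinite_equal_columns[OF psd]; simp add: M_def aq_matrix_def assms)+
  ultimately have "a01 = 0" "b01 = 0"
    by (simp_all add: M_def aq_matrix_def)
  define x :: "real ^ 9" where
    "x = u *\<^sub>R (axis 2 1 - axis 4 1) + v *\<^sub>R (axis 3 1 - axis 5 1)"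
  have "0 \<le> x \<bullet> (M *v x)"
    using psd by (simp add: positive_semidefinite_def)
  also have "x \<bullet> (M *v x) = u\<^sup>2 * (M $ 2 $ 2 - M $ 2 $ 4 - M $ 4 $ 2 + M $ 4 $ 4)
     + u * v * (M $ 2 $ 3 - M $ 2 $ 5 - M $ 4 $ 3 + M $ 4 $ 5)
     + u * v * (M $ 3 $ 2 - M $ 3 $ 4 - M $ 5 $ 2 + M $ 5 $ 4)
     + v\<^sup>2 * (M $ 3 $ 3 - M $ 3 $ 5 - M $ 5 $ 3 + M $ 5 $ 5)"
    by (simp add: x_def matrix_vector_mult_diff_distrib matrix_vector_right_distrib
        matrix_vector_mult_scaleR inner_diff inner_add axis_inner_mult_axis)
      (simp add: algebra_simps power2_eq_square)
  also have "\<dots> = u\<^sup>2 * (pA 0 + pB 0 - 2 * p 0 0) - 2 * u * v * (pA 0 + pB 0)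
             + v\<^sup>2 * (pA 1 + pB 1)"
    using assms \<open>a01 = 0\<close> \<open>b01 = 0\<close> by (simp add: M_def aq_matrix_def algebra_simps)
  finally show ?thesis .
qed

text \<open>The parameters are the only possible ones: the zero diagonal entry and the coinciding
  columns force each of them to be 0 or \<open>q\<close>.\<close>

lemma hardy_matrix_positive_semidefinite:
  fixes f q s :: real
  assumes f: "f\<^sup>2 = f + 1" and s: "s = f * q" and q: "0 \<le> q" "0 \<le> s"
    and unit: "q * (f ^ 5) = 1"
    and "pA 0 = q + s" "pA 1 = q + 2 * s" "pB 0 = q + s" "pB 1 = q + 2 * s"
    and "p 0 0 = q" "p 0 1 = q + s" "p 1 0 = q + s" "p 1 1 = 0"
  shows "positive_semidefinite (aq_matrix pA pB p 0 0 q 0 q 0 0 q)"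
  unfolding positive_semidefinite_def
proof (intro conjI allI)
  show "transpose (aq_matrix pA pB p 0 0 q 0 q 0 0 q) = aq_matrix pA pB p 0 0 q 0 q 0 0 q"
    by (simp add: vec_eq_iff forall_9 aq_matrix_def transpose_def)
next
  fix x :: "real ^ 9"
  \<comment> \<open>Coinciding columns let the form see only the sums of their coordinates;
    \<open>x $ 9\<close> drops out because its row is zero.\<close>
  define A0 A1 B0 B1 where "A0 = x $ 2 + x $ 7" and "A1 = x $ 3" and "B0 = x $ 4 + x $ 8"
    and "B1 = x $ 5"
  \<comment> \<open>This turns the constant entry 1 into a multiple of \<open>q\<close>, so that all
    coefficients scale with \<open>q\<close>.\<close>
  have "f ^ 5 = 5 * f + 3" using f by algebra
  then have one: "1 = q * (5 * f + 3)" using unit by simp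
  \<comment> \<open>All entries of row 6 but the last equal \<open>q\<close>; completing the square
    in \<open>x $ 6\<close> splits off the first term.\<close>
  have "x \<bullet> (aq_matrix pA pB p 0 0 q 0 q 0 0 q *v x) =
      q * (x $ 1 + A0 + A1 + B0 + B1 + x $ 6)\<^sup>2
      + ((1 - q) * (x $ 1)\<^sup>2 + 2 * s * x $ 1 * (A0 + B0) + 4 * s * x $ 1 * (A1 + B1)
      + s * (A0\<^sup>2 + B0\<^sup>2) + 2 * s * (A1\<^sup>2 + B1\<^sup>2) - 2 * q * A0 * A1 - 2 * q * B0 * B1
      + 2 * s * A0 * B1 + 2 * s * A1 * B0 - 2 * q * A1 * B1)"
    using assms
    by (simp add: inner_vec_def matrix_vector_mult_def sum_9 aq_matrix_def A0_def A1_def B0_def B1_def)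
      (simp add: algebra_simps power2_eq_square)
  \<comment> \<open>Exchange of the parties separates the rest. The part in \<open>A0 - B0\<close>
    and \<open>A1 - B1\<close> is a perfect square because \<open>s = f * q\<close>; in the
    symmetric part, squares are completed in \<open>A0 + B0\<close>, then in
    \<open>A1 + B1\<close>.\<close>
  also have "\<dots> = q * (x $ 1 + A0 + A1 + B0 + B1 + x $ 6)\<^sup>2
      + s / 2 * (A0 - B0 - f * (A1 - B1))\<^sup>2
      + s / 2 * (A0 + B0 + (2 - f) * (A1 + B1) + 2 * x $ 1)\<^sup>2
      + q * (A1 + B1 + f\<^sup>2 * x $ 1)\<^sup>2"
  proof -
    have eq: "(1 - q) * (x $ 1)\<^sup>2 = q * (5 * f + 2) * (x $ 1)\<^sup>2"
      by (subst one) (simp add: algebra_simps)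
    have ff: "f * f = f + 1" using f by (simp add: power2_eq_square)
    have ff': "f * (f * z) = f * z + z" for z
      unfolding mult.assoc[symmetric] ff by (simp add: algebra_simps)
    show ?thesis
      unfolding s eq f by (simp add: ff ff' field_simps power2_eq_square)
  qed
  also have "\<dots> \<ge> 0" using q by simp
  finally show "0 \<le> x \<bullet> (aq_matrix pA pB p 0 0 q 0 q 0 0 q *v x)" .
qed

text \<open>Modulo \<open>f^2 = f + 1\<close> the condition is linear in \<mu>, and the quotient of
  \<open>32 - 14 * f\<close> by \<open>13 + 24 * f\<close> simplifies to \<open>10 * f - 16\<close>.
  The factor \<open>(5 - f) / 19\<close> is \<alpha>.\<close>

lemma golden_ratio_bound:
  fixes f \<mu> :: real
  assumes f: "f\<^sup>2 = f + 1" and "0 < f"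
    and le: "0 \<le> 2 * (1 - \<mu>) * ((5 - f) / 19 * (3 - f)) - \<mu> * (2 * f - 1)"
  shows "\<mu> \<le> 10 * f - 16"
proof -
  have "(5 - f) / 19 * (3 - f) = (16 - 7 * f) / 19"
    using f by (simp add: field_simps power2_eq_square)
  from le[unfolded this] have a: "\<mu> * (13 + 24 * f) \<le> 32 - 14 * f"
    by (simp add: field_simps)
  have b: "32 - 14 * f = (10 * f - 16) * (13 + 24 * f)"
    using f by (simp add: field_simps power2_eq_square)
  have c: "0 < 13 + 24 * f" using \<open>0 < f\<close> by simp
  show ?thesis
    by (rule mult_right_le_imp_le[OF a[unfolded b] c])
qed

theorem mainTheorem2:
  fixes \<alpha> :: real and P H :: "real ^ 3 ^ 3" and l2 :: "real \<Rightarrow> real ^ 3 ^ 3"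
  assumes "\<alpha> = (9 - sqrt 5) / 38"
    and "P = vector [vector [1,   1/2, 1/2],
                     vector [1/2, 1/2, 1/2],
                     vector [1/2, 1/2, 0]]"
    and "H = vector [vector [1,     \<alpha>, 2 * \<alpha>],
                     vector [\<alpha>,     0, \<alpha>],
                     vector [2 * \<alpha>, \<alpha>, 0]]"
    and "\<And>\<mu>. l2 \<mu> = \<mu> *\<^sub>R P + (1 - \<mu>) *\<^sub>R H"
  shows "l2 (5 * sqrt 5 - 11) \<in> almost_quantum_set \<and>
         (\<forall>\<mu>. l2 \<mu> \<in> almost_quantum_set \<longrightarrow> \<mu> \<le> 5 * sqrt 5 - 11)"
proof (intro conjI allI impI)
  define f :: real where "f = (1 + sqrt 5) / 2"
  have f: "f\<^sup>2 = f + 1" by (simp add: f_def power2_eq_square field_simps)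
  have sqrt5: "sqrt 5 = 2 * f - 1" by (simp add: f_def field_simps)
  have \<alpha>: "\<alpha> = (5 - f) / 19" using assms(1) by (simp add: f_def field_simps)
  have "sqrt 5 < 9 / 4" by (rule real_less_lsqrt) (simp_all add: power2_eq_square)
  \<comment> \<open>Gives \<open>8 / 5 < f\<close>, hence the positivity of
    \<open>5 * f - 8\<close>.\<close>
  moreover have "11 / 5 < sqrt 5" by (rule real_less_rsqrt) (simp add: power2_eq_square)
  ultimately have f_bounds: "8 / 5 < f" "f < 13 / 8" by (simp_all add: f_def)

  \<comment> \<open>This is \<open>f\<close> to the power -5, and half the claimed maximum, since
    p(0,0) = \<mu>/2 on the line.\<close>
  define q where "q = 5 * f - 8"
  define s where "s = f * q"
  have "0 \<le> q" "0 \<le> s" using f_bounds by (simp_all add: q_def s_def)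
  have "q * f ^ 5 = 1" using f unfolding q_def by algebra
  \<comment> \<open>The table is symmetric in the two parties, so \<open>pA\<close> also serves as
    Bob's marginal.\<close>
  define pA :: "2 \<Rightarrow> real" where "pA = (\<lambda>i. if i = 0 then q + s else q + 2 * s)"
  define p :: "2 \<Rightarrow> 2 \<Rightarrow> real" where
    "p = (\<lambda>i j. if i = 0 then if j = 0 then q else q + s else if j = 0 then q + s else 0)"
  have "positive_semidefinite (aq_matrix pA pA p 0 0 q 0 q 0 0 q)"
    by (rule hardy_matrix_positive_semidefinite[OF f s_def \<open>0 \<le> q\<close> \<open>0 \<le> s\<close> \<open>q * f ^ 5 = 1\<close>])
      (simp_all add: pA_def p_def)
  moreover have "l2 (5 * sqrt 5 - 11) = collins_gisin pA pA p"
  proof -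
    have "(1 - 2 * q) * \<alpha> = s"
      using f unfolding s_def \<alpha> q_def by (simp add: field_simps power2_eq_square)
    moreover have "5 * sqrt 5 - 11 = 2 * q" by (simp add: q_def sqrt5)
    ultimately show ?thesis
      unfolding assms(2-4) collins_gisin_def
      by (simp add: vec_eq_iff forall_3 pA_def p_def algebra_simps)
  qed
  ultimately show "l2 (5 * sqrt 5 - 11) \<in> almost_quantum_set"
    unfolding almost_quantum_set_def by blast

  fix \<mu> assume "l2 \<mu> \<in> almost_quantum_set"
  then obtain pA pB p a01 b01 c0_01 c1_01 c01_0 c01_1 c01_01 c01_10
    where table: "l2 \<mu> = collins_gisin pA pB p"
      and psd: "positive_semidefinite
        (aq_matrix pA pB p a01 b01 c0_01 c1_01 c01_0 c01_1 c01_01 c01_10)"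
    unfolding almost_quantum_set_def by blast
  have entry: "collins_gisin pA pB p $ i $ j = l2 \<mu> $ i $ j" for i j
    using table by simp
  have entries: "pA 0 = \<mu> / 2 + (1 - \<mu>) * \<alpha>" "pA 1 = \<mu> / 2 + 2 * (1 - \<mu>) * \<alpha>"
    "pB 0 = \<mu> / 2 + (1 - \<mu>) * \<alpha>" "pB 1 = \<mu> / 2 + 2 * (1 - \<mu>) * \<alpha>"
    "p 0 0 = \<mu> / 2" "p 0 1 = pA 0" "p 1 0 = pB 0" "p 1 1 = 0"
    using entry[of 1 2] entry[of 1 3] entry[of 2 1] entry[of 2 2] entry[of 2 3]
      entry[of 3 1] entry[of 3 2] entry[of 3 3]
    by (simp_all add: assms(2-4) collins_gisin_def)
  \<comment> \<open>The choice \<open>u = f\<close>, \<open>v = 1\<close> is a null direction of the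
    extremal matrix: it annihilates \<open>A0 - B0 - f * (A1 - B1)\<close> and the symmetric
    squares, so the bound is tight.\<close>
  have "0 \<le> f\<^sup>2 * (pA 0 + pB 0 - 2 * p 0 0) - 2 * f * 1 * (pA 0 + pB 0) + 1\<^sup>2 * (pA 1 + pB 1)"
    by (rule hardy_table_antisymmetric_form[OF psd]) (simp_all add: entries)
  also have "\<dots> = 2 * (1 - \<mu>) * (\<alpha> * (3 - f)) - \<mu> * (2 * f - 1)"
    unfolding f entries by (simp add: field_simps)
  finally have "0 \<le> 2 * (1 - \<mu>) * (\<alpha> * (3 - f)) - \<mu> * (2 * f - 1)" .
  then have "\<mu> \<le> 10 * f - 16"
    unfolding \<alpha> using f f_bounds by (intro golden_ratio_bound) simp_all
  then show "\<mu> \<le> 5 * sqrt 5 - 11" by (simp add: sqrt5)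
qed

end
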